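(* Let $\{a_N\}_{N \geq 1}$ and $\{b_N\}_{N \geq 1}$ be sequences of nonnegative integers with the property that, for every positive integer $N$, there exists a polynomial $P \in S_N$ such that $x^{a_N}(1 - x)^{b_N}$ divides $P(x)$ in $\mathbb{Z}[x]$. Then $$\liminf_{N \to \infty} \frac{a_N + b_N}{N} \leq \frac{5}{6}.$$
   Context: For every positive integer $N$, let $\ell_N := \operatorname{lcm}\{1,2,\dots,N\}$. For a polynomial $P \in \mathbb{Z}[x]$, put $I(P) := \int_0^1 P(x)\,\mathrm{d}x$. Define $$S_N := \big\{P \in \mathbb{Z}[x] : \deg(P) < N,\ I(P) = 1/\ell_N\big\}.$$ *)

theory Defs
  imports "HOL-Analysis.Analysis" "HOL-Computational_Algebra.Polynomial"
begin

definition ell :: "nat \<Rightarrow> nat" where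
  "ell N = Lcm {1..N}"

definition integral01 :: "int poly \<Rightarrow> real" where
  "integral01 P = integral {0..1} (\<lambda>x::real. poly (map_poly real_of_int P) x)"

(* The convention degree 0 = 0 is harmless: the zero polynomial has integral 0, so it is
   excluded by the second condition. *)
definition S :: "nat \<Rightarrow> int poly set" where
  "S N = {P. degree P < N \<and> integral01 P = 1 / real (ell N)}"

end

theory Submission
  imports Defs
begin

text \<open>
  Multiplying the condition \<open>I(P) = 1/\<ell>\<^sub>N\<close> by \<open>\<ell>\<^sub>N\<close> gives an identity of integers:
  if \<open>P = \<Sum> c\<^sub>n x\<^sup>n\<close>, then \<open>\<Sum> c\<^sub>n \<cdot> \<ell>\<^sub>N/(n + 1) = 1\<close>. Let \<open>q \<le> N\<close> be a power of a prime
  \<open>p\<close>. As \<open>q\<close> divides \<open>\<ell>\<^sub>N\<close>, the quotient \<open>\<ell>\<^sub>N/(n + 1)\<close> is divisible by \<open>p\<close> whenever \<open>q\<close>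
  does not divide \<open>n + 1\<close>. So some coefficient \<open>c\<^sub>n\<close> with \<open>q\<close> dividing \<open>n + 1\<close> is prime to \<open>p\<close>.

  This limits how far \<open>P\<close> can vanish at the end points. Modulo \<open>p\<close>, the polynomial
  \<open>x\<^bsup>iq\<^esup> (1 - x)\<^bsup>kq\<^esup>\<close> is a polynomial in \<open>x\<^sup>q\<close>. If it divides \<open>P\<close> and \<open>i + k\<close> is at
  least the integer part of \<open>N/q\<close>, the cofactor has degree less than \<open>q - 1\<close>, hence all \<open>c\<^sub>n\<close> with
  \<open>n \<equiv> -1\<close> modulo \<open>q\<close> vanish modulo \<open>p\<close>: a contradiction (lemma \<open>no_prime_power_vanishing\<close>).

  For a prime power \<open>q\<close> with \<open>q \<le> N < 2q\<close> this shows that both exponents are less than \<open>q\<close>; for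
  a prime power \<open>r\<close> with \<open>r \<le> N < 3r\<close> it shows that one of them is less than \<open>r\<close>. Together the sum
  of the exponents is less than \<open>q + r\<close>. The bound is about \<open>N/2 + N/3 = 5N/6\<close> when \<open>q\<close> is close
  to \<open>N/2\<close> and \<open>r\<close> is close to \<open>N/3\<close>. A bound on the lower limit asks for this only
  at infinitely many \<open>N\<close>, and there powers of \<open>2\<close> and of \<open>3\<close> can serve: \<open>log\<^sub>2 3\<close> is irrational
  and therefore \<open>3\<^sup>m\<close> exceeds a power of \<open>2\<close> by a factor arbitrarily close to \<open>1\<close> for
  arbitrarily large \<open>m\<close> (lemma \<open>power_3_slightly_above_power_2\<close>).
\<close>

section \<open>The integral as an integer identity\<close>

lemma integral01_eq_sum_coeff:
  "integral01 P = (\<Sum>n\<le>degree P. real_of_int (coeff P n) / real (n + 1))"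
proof -
  have "((\<lambda>x::real. \<Sum>n\<le>degree P. real_of_int (coeff P n) * x ^ n) has_integral
      (\<Sum>n\<le>degree P. real_of_int (coeff P n) * (1 / real (n + 1)))) {0..1}"
  proof (intro has_integral_sum has_integral_mult_right)
    fix n
    have "((\<lambda>x::real. x ^ n) has_integral
        (1 ^ (n + 1) / real (n + 1) - 0 ^ (n + 1) / real (n + 1))) {0..1}"
    proof (rule fundamental_theorem_of_calculus)
      fix x :: real
      show "((\<lambda>x. x ^ (n + 1) / real (n + 1)) has_vector_derivative x ^ n) (at x within {0..1})"
        using DERIV_cdivide[OF DERIV_pow[of "n + 1" x "{0..1}"], of "real (n + 1)"]
        by (simp del: of_nat_Suc flip: has_real_derivative_iff_has_vector_derivative)
    qed simp
    then show "((\<lambda>x::real. x ^ n) has_integral (1 / real (n + 1))) {0..1}"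
      by simp
  qed auto
  then show ?thesis
    by (simp add: integral01_def poly_altdef degree_map_poly coeff_map_poly integral_unique)
qed

lemma dvd_ell: "1 \<le> d \<Longrightarrow> d \<le> N \<Longrightarrow> d dvd ell N"
  unfolding ell_def by (rule dvd_Lcm) simp

lemma ell_pos: "ell N > 0"
  unfolding ell_def by (rule Nat.gr0I) (simp add: Lcm_0_iff)

lemma sum_coeff_times_cofactor_eq_1:
  assumes "P \<in> S N"
  shows "(\<Sum>n\<le>degree P. coeff P n * int (ell N div (n + 1))) = 1"
proof -
  have deg: "degree P < N" and I: "integral01 P = 1 / real (ell N)"
    using assms by (auto simp: S_def)
  have "real_of_int (\<Sum>n\<le>degree P. coeff P n * int (ell N div (n + 1)))
      = (\<Sum>n\<le>degree P. real (ell N) * (real_of_int (coeff P n) / real (n + 1)))"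
    unfolding of_int_sum
  proof (rule sum.cong)
    fix n assume "n \<in> {..degree P}"
    with deg have "n + 1 dvd ell N"
      by (intro dvd_ell) auto
    then have "real (ell N div (n + 1)) = real (ell N) / real (n + 1)"
      by (rule real_of_nat_div)
    then show "real_of_int (coeff P n * int (ell N div (n + 1)))
        = real (ell N) * (real_of_int (coeff P n) / real (n + 1))"
      by simp
  qed simp
  also have "\<dots> = real (ell N) * integral01 P"
    by (simp add: integral01_eq_sum_coeff sum_distrib_left)
  also have "\<dots> = 1"
    using I ell_pos[of N] by simp
  finally show ?thesis
    by linarith
qed

section \<open>Vanishing at the end points\<close>

lemma prime_dvd_if_prime_power_dvd_mult:
  fixes p :: nat
  assumes "prime p" "p ^ j dvd m * n" "\<not> p ^ j dvd m"
  shows "p dvd n"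
proof (rule ccontr)
  assume "\<not> p dvd n"
  then have "coprime (p ^ j) n"
    using assms(1) by (simp add: prime_imp_coprime)
  with assms(2,3) show False
    by (simp add: coprime_dvd_mult_left_iff)
qed

text \<open>
  Modulo \<open>p\<close>, the polynomial \<open>(1 - x)\<^bsup>kq\<^esup>\<close> is a polynomial in \<open>x\<^sup>q\<close>. The absorption identity
  \<open>n \<cdot> (kq choose n) = kq \<cdot> (kq - 1 choose n - 1)\<close> shows this for all \<open>k\<close> at once.
\<close>

lemma prime_dvd_choose_prime_power_mult:
  fixes p :: nat
  assumes "prime p" "\<not> p ^ j dvd n"
  shows "p dvd ((k * p ^ j) choose n)"
proof -
  have "n > 0"
    using assms(2) by (intro gr0I) auto
  then have "n * ((k * p ^ j) choose n) = k * p ^ j * ((k * p ^ j - 1) choose (n - 1))"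
    by (rule times_binomial_minus1_eq)
  then have "p ^ j dvd n * ((k * p ^ j) choose n)"
    by simp
  then show ?thesis
    using assms by (intro prime_dvd_if_prime_power_dvd_mult[of p j n])
qed

lemma coeff_one_minus_X_power:
  "coeff ([:1, -1:] ^ m) n = (-1) ^ n * (of_nat (m choose n) :: 'a :: comm_ring_1)"
proof -
  have "[:1, -1 :: 'a:] ^ m = (monom (-1) 1 + 1) ^ m"
    by (simp add: monom_altdef one_pCons)
  also have "\<dots> = (\<Sum>i\<le>m. monom (of_nat (m choose i) * (-1) ^ i) i)"
    by (simp add: binomial_ring monom_power of_nat_poly smult_monom)
  finally show ?thesis
    by (auto simp: coeff_sum binomial_eq_0 mult.commute)
qed

text \<open>
  A factor that is modulo \<open>p\<close> a polynomial in \<open>x\<^sup>q\<close> preserves residue classes of exponents modulo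
  \<open>q\<close>; a cofactor of degree less than \<open>q - 1\<close> has no term in the class of \<open>-1\<close>.
\<close>

lemma prime_dvd_coeff_of_low_degree_cofactor:
  fixes R :: "int poly" and p j :: nat
  defines "q \<equiv> p ^ j"
  assumes p: "prime p" and R: "degree R + 1 < q" and n: "q dvd n + 1"
  shows "int p dvd coeff ([:0, 1:] ^ (i * q) * [:1, -1:] ^ (k * q) * R) n"
proof -
  have *: "int p dvd coeff ([:1, -1:] ^ (k * q) * R) m" if m: "q dvd m + 1" for m
    unfolding coeff_mult
  proof (rule dvd_sum)
    fix l assume l: "l \<in> {..m}"
    show "int p dvd coeff ([:1, -1:] ^ (k * q)) l * coeff R (m - l)"
    proof (cases "q dvd l")
      case True
      with m have "q dvd m + 1 - l"
        by (rule dvd_diff_nat)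
      with l have "q \<le> m - l + 1"
        by (intro dvd_imp_le) (auto simp: Suc_diff_le)
      with R have "coeff R (m - l) = 0"
        by (intro coeff_eq_0) simp
      then show ?thesis
        by simp
    next
      case False
      then have "p dvd ((k * q) choose l)"
        unfolding q_def by (rule prime_dvd_choose_prime_power_mult[OF p])
      then show ?thesis
        by (simp add: coeff_one_minus_X_power)
    qed
  qed
  have X: "[:0, 1 :: int:] ^ (i * q) = monom 1 (i * q)"
    by (simp add: monom_altdef)
  show ?thesis
  proof (cases "i * q \<le> n")
    case True
    have "q dvd n + 1 - i * q"
      using n by (rule dvd_diff_nat) simp
    with True have "q dvd n - i * q + 1"
      by (simp add: Suc_diff_le)
    with True * show ?thesis
      by (simp add: X mult.assoc coeff_monom_mult)
  next
    case False
    then show ?thesis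
      by (simp add: X mult.assoc coeff_monom_mult)
  qed
qed

text \<open>
  The hypothesis on \<open>i + k\<close> leaves for the cofactor a degree of at most \<open>q - 2\<close>. Then \<open>p\<close> divides
  every term of \<open>\<Sum> c\<^sub>n \<cdot> \<ell>\<^sub>N/(n + 1) = 1\<close>: the coefficient if \<open>q\<close> divides \<open>n + 1\<close>, the quotient
  otherwise.
\<close>

lemma no_prime_power_vanishing:
  fixes p j :: nat
  defines "q \<equiv> p ^ j"
  assumes P: "P \<in> S N" and p: "prime p" and q: "q \<le> N" "N < (i + k + 1) * q"
  shows "\<not> [:0, 1:] ^ (i * q) * [:1, -1:] ^ (k * q) dvd P"
proof
  assume "[:0, 1:] ^ (i * q) * [:1, -1:] ^ (k * q) dvd P"
  then obtain R where R: "P = [:0, 1:] ^ (i * q) * [:1, -1:] ^ (k * q) * R"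
    by (elim dvdE)
  have sum1: "(\<Sum>n\<le>degree P. coeff P n * int (ell N div (n + 1))) = 1"
    using P by (rule sum_coeff_times_cofactor_eq_1)
  have deg: "degree P < N"
    using P by (simp add: S_def)
  have "P \<noteq> 0"
    using sum1 by auto
  then have "R \<noteq> 0"
    using R by auto
  then have "degree P = i * q + k * q + degree R"
    by (simp add: R degree_mult_eq degree_power_eq)
  with deg q(2) have degR: "degree R + 1 < q"
    by (simp add: algebra_simps)
  have "int p dvd (\<Sum>n\<le>degree P. coeff P n * int (ell N div (n + 1)))"
  proof (rule dvd_sum)
    fix n assume n: "n \<in> {..degree P}"
    show "int p dvd coeff P n * int (ell N div (n + 1))"
    proof (cases "q dvd n + 1")
      case True
      then have "int p dvd coeff P n"
        unfolding R q_def
        by (intro prime_dvd_coeff_of_low_degree_cofactor p) (use degR in \<open>simp_all add: q_def\<close>)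
      then show ?thesis
        by simp
    next
      case False
      have "n + 1 dvd ell N"
        using n deg by (intro dvd_ell) auto
      then have "(n + 1) * (ell N div (n + 1)) = ell N"
        by (rule dvd_mult_div_cancel)
      moreover have "q dvd ell N"
        using q p by (intro dvd_ell) (auto simp: q_def prime_gt_0_nat Suc_le_eq)
      ultimately have "p dvd ell N div (n + 1)"
        using prime_dvd_if_prime_power_dvd_mult[OF p, of j "n + 1" "ell N div (n + 1)"] False
        by (simp add: q_def)
      then show ?thesis
        by simp
    qed
  qed
  with sum1 p show False
    by simp
qed

text \<open>
  The three uses of the previous lemma: \<open>(i, k) = (1, 0)\<close> and \<open>(0, 1)\<close> for the power near \<open>N/2\<close>,
  and \<open>(1, 1)\<close> for the power near \<open>N/3\<close>.
\<close>

lemma exponent_sum_less: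
  fixes p p' j j' :: nat
  defines "q \<equiv> p ^ j" and "r \<equiv> p' ^ j'"
  assumes P: "P \<in> S N" and dvd: "[:0, 1:] ^ a * [:1, -1:] ^ b dvd P"
    and p: "prime p" "q \<le> N" "N < 2 * q"
    and p': "prime p'" "r \<le> N" "N < 3 * r"
  shows "a + b + 1 < q + r"
proof -
  have dvd': "[:0, 1:] ^ m * [:1, -1:] ^ n dvd P" if "m \<le> a" "n \<le> b" for m n
    using that dvd by (meson dvd_trans le_imp_power_dvd mult_dvd_mono)
  have "a < q"
  proof (rule ccontr)
    assume "\<not> a < q"
    then show False
      using no_prime_power_vanishing[OF P p(1), of j 1 0] dvd'[of q 0] p by (simp add: q_def)
  qed
  moreover have "b < q"
  proof (rule ccontr)
    assume "\<not> b < q"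
    then show False
      using no_prime_power_vanishing[OF P p(1), of j 0 1] dvd'[of 0 q] p by (simp add: q_def)
  qed
  moreover have "a < r \<or> b < r"
  proof (rule ccontr)
    assume "\<not> (a < r \<or> b < r)"
    then show False
      using no_prime_power_vanishing[OF P p'(1), of j' 1 1] dvd'[of r r] p' by (simp add: r_def)
  qed
  ultimately show ?thesis
    by linarith
qed

section \<open>Powers of 2 and 3\<close>

lemma power_3_eq_powr: "(3 :: real) ^ n = 2 powr (real n * log 2 3)"
  by (simp add: mult.commute[of "real n"] powr_realpow flip: powr_powr)

lemma log_2_3_irrational: "log 2 3 \<notin> \<rat>"
proof
  assume "log 2 3 \<in> \<rat>"
  then obtain m n :: nat where "n \<noteq> 0" and mn: "\<bar>log 2 3 :: real\<bar> = real m / real n"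
    by (rule Rats_abs_nat_div_natE)
  have "log 2 3 > (0 :: real)"
    by simp
  with mn \<open>n \<noteq> 0\<close> have "real n * log 2 3 = real m"
    by (simp add: field_simps)
  then have "(3 :: real) ^ n = 2 ^ m"
    by (simp add: power_3_eq_powr powr_realpow)
  then have "(3 :: nat) ^ n = 2 ^ m"
    by (metis (mono_tags) of_nat_eq_iff of_nat_numeral of_nat_power)
  moreover have "odd ((3 :: nat) ^ n)"
    by simp
  ultimately have "m = 0"
    by (cases m) auto
  with \<open>(3 :: nat) ^ n = 2 ^ m\<close> \<open>n \<noteq> 0\<close> show False
    by simp
qed

text \<open>
  The ratio of \<open>3\<^sup>n\<close> to the largest power of \<open>2\<close> below it is \<open>2\<close> to the fractional part of
  \<open>n log\<^sub>2 3\<close>. Restricting to multiples \<open>n\<close> of \<open>M\<close> makes the exponents large.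
\<close>

lemma power_3_slightly_above_power_2:
  fixes \<epsilon> :: real
  assumes "\<epsilon> > 0"
  obtains m n :: nat where "m \<ge> M" "n \<ge> 1" "(2::nat) ^ m \<le> 3 ^ n" "3 ^ n < (1 + \<epsilon>) * 2 ^ m"
proof -
  define K where "K = max M 1"
  define \<theta> where "\<theta> = real K * log 2 3"
  have "\<theta> \<notin> \<rat>"
  proof
    assume "\<theta> \<in> \<rat>"
    then have "\<theta> / real K \<in> \<rat>"
      by (intro Rats_divide) auto
    then show False
      using log_2_3_irrational by (simp add: \<theta>_def K_def)
  qed
  moreover have "log 2 (1 + \<epsilon>) > 0"
    using assms by simp
  ultimately obtain k where k: "k > 0" "\<bar>frac (real k * \<theta>) - 0\<bar> < log 2 (1 + \<epsilon>)"
    using Kronecker_approx_1_explicit[of \<theta> 0 "log 2 (1 + \<epsilon>)"] by auto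
  define n m where "n = k * K" and "m = nat \<lfloor>real n * log 2 3\<rfloor>"
  have kt: "real k * \<theta> = real n * log 2 3"
    by (simp add: \<theta>_def n_def)
  have log_ge_1: "log 2 3 \<ge> (1 :: real)"
    by simp
  then have "real n * 1 \<le> real n * log 2 3"
    by (intro mult_left_mono) auto
  then have "int n \<le> \<lfloor>real n * log 2 3\<rfloor>"
    by (simp add: le_floor_iff)
  then have "n \<le> m" and m: "real n * log 2 3 = real m + frac (real k * \<theta>)"
    by (auto simp: m_def frac_def kt)
  have pow: "(3 :: real) ^ n = 2 ^ m * 2 powr frac (real k * \<theta>)"
    by (simp add: power_3_eq_powr m powr_add powr_realpow)
  have "2 powr frac (real k * \<theta>) < 2 powr log 2 (1 + \<epsilon>)"
    using k by (intro powr_less_mono) auto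
  then have upper: "(3 :: real) ^ n < (1 + \<epsilon>) * 2 ^ m"
    using assms by (simp add: pow)
  have "2 powr frac (real k * \<theta>) \<ge> 1"
    by (simp add: ge_one_powr_ge_zero frac_ge_0)
  then have "(2 :: real) ^ m \<le> 3 ^ n"
    by (simp add: pow)
  then have "real (2 ^ m) \<le> real (3 ^ n)"
    by simp
  then have lower: "(2 :: nat) ^ m \<le> 3 ^ n"
    by (simp only: of_nat_le_iff)
  have "K \<le> n"
    using k by (simp add: n_def)
  then show ?thesis
    using that[of m n] lower upper \<open>n \<le> m\<close> by (simp add: K_def)
qed

section \<open>The bound on the lower limit\<close>

text \<open>
  With \<open>N = 2\<^sup>m - 1\<close> the power \<open>2\<^bsup>m-1\<^esup>\<close> is exactly \<open>(N + 1)/2\<close>, and the power of \<open>3\<close> lies in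
  the interval from \<open>(N + 1)/3\<close> to \<open>(1 + \<epsilon>)(N + 1)/3\<close>.
\<close>

theorem theorem1p5:
  fixes a b :: "nat \<Rightarrow> nat"
  assumes "\<And>N. N \<ge> 1 \<Longrightarrow> \<exists>P \<in> S N. [:0, 1:] ^ a N * [:1, -1:] ^ b N dvd P"
  shows "liminf (\<lambda>N. ereal ((real (a N) + real (b N)) / real N)) \<le> ereal (5 / 6)"
proof (rule ccontr)
  assume "\<not> ?thesis"
  then obtain c where c: "ereal (5 / 6) < ereal c"
      "ereal c < liminf (\<lambda>N. ereal ((real (a N) + real (b N)) / real N))"
    using ereal_dense2[of "ereal (5 / 6)"] by (auto simp only: not_le)
  then have "eventually (\<lambda>N. ereal c < ereal ((real (a N) + real (b N)) / real N)) sequentially"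
    by (intro less_LiminfD)
  then obtain N0 where N0: "\<And>N. N \<ge> N0 \<Longrightarrow> c < (real (a N) + real (b N)) / real N"
    by (auto simp: eventually_sequentially)
  define \<epsilon> where "\<epsilon> = min 1 (3 * (c - 5 / 6))"
  have \<epsilon>: "0 < \<epsilon>" "\<epsilon> \<le> 1" "5 / 6 + \<epsilon> / 3 \<le> c"
    using c(1) by (auto simp: \<epsilon>_def min_def field_simps)
  obtain m n :: nat where mn: "m \<ge> N0 + 2" "n \<ge> 1" "(2::nat) ^ m \<le> 3 ^ n"
      "3 ^ n < (1 + \<epsilon>) * 2 ^ m"
    using power_3_slightly_above_power_2[OF \<epsilon>(1)] by blast
  define N q r :: nat where "N = 2 ^ m - 1" and "q = 2 ^ (m - 1)" and "r = 3 ^ (n - 1)"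
  have q: "2 ^ m = 2 * q"
    using mn(1) by (cases m) (auto simp: q_def)
  have r: "3 ^ n = 3 * r"
    using mn(2) by (cases n) (auto simp: r_def)
  have "m < 2 ^ m"
    by (rule less_exp)
  then have "N \<ge> N0" "N \<ge> 1"
    using mn(1) unfolding N_def by linarith+
  have Nq: "N + 1 = 2 * q"
    using \<open>m < 2 ^ m\<close> by (simp add: N_def flip: q)
  have Nq': "real N + 1 = 2 * real q"
    using Nq by linarith
  have "real (3 ^ n) < (1 + \<epsilon>) * real (2 ^ m)"
    using mn(4) by simp
  then have r_upper: "3 * real r < (1 + \<epsilon>) * (real N + 1)"
    unfolding q r Nq' by simp
  also have "\<dots> \<le> 2 * (real N + 1)"
    using \<epsilon> by (intro mult_right_mono) auto
  finally have "r \<le> N"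
    by simp
  have "N < 3 * r"
    using mn(3) Nq unfolding q r by linarith
  obtain P where P: "P \<in> S N" "[:0, 1:] ^ a N * [:1, -1:] ^ b N dvd P"
    using assms[OF \<open>N \<ge> 1\<close>] by blast
  have "a N + b N + 1 < q + r"
    using exponent_sum_less[OF P, of 2 "m - 1" 3 "n - 1"] Nq \<open>N \<ge> 1\<close> \<open>r \<le> N\<close> \<open>N < 3 * r\<close>
    by (simp add: q_def r_def)
  then have "real (a N) + real (b N) + 2 \<le> real q + real r"
    by linarith
  also have "\<dots> \<le> (real N + 1) / 2 + (1 + \<epsilon>) * (real N + 1) / 3"
    using r_upper Nq' by (intro add_mono) simp_all
  also have "\<dots> = (5 / 6 + \<epsilon> / 3) * real N + (5 / 6 + \<epsilon> / 3)"
    by (simp add: field_simps)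
  finally have "real (a N) + real (b N) \<le> (5 / 6 + \<epsilon> / 3) * real N"
    using \<epsilon>(2) by linarith
  also have "\<dots> \<le> c * real N"
    using \<epsilon>(3) by (intro mult_right_mono) auto
  finally have "(real (a N) + real (b N)) / real N \<le> c"
    using \<open>N \<ge> 1\<close> by (simp add: field_simps)
  with N0[OF \<open>N \<ge> N0\<close>] show False
    by simp
qed

end
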